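(* Let $(\lambda,v)$ be a simple eigenpair of the problem $A(v)v=\lambda v$, with $\lambda\neq 0$ and $\frac12 v^Tv=1$, let $u\in\mathbb{R}^n\setminus\{0\}$ be a left eigenvector of $J(v)$ corresponding to $\lambda$ (i.e. $u^TJ(v)=\lambda u^T$), and let $\theta:=\arccos\left(\frac{u^Tv}{\|u\|\|v\|}\right)$ be the angle between $u$ and $v$. Let $w_1,\dots,w_m\ge0$ be given weights. Then $$\kappa_{\mathrm{sym}}^{(2)}(\lambda)=\kappa(\lambda)\quad\text{and}\quad \kappa_{\mathrm{sym}}^{(F)}(\lambda)=\beta\,\kappa(\lambda),\qquad\text{where } \beta:=\sqrt{\frac{1+(\cos\theta)^2}{2}}.$$ (Here $\kappa(\lambda)$ may be taken with respect to either the spectral or the Frobenius norm.)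
   Context: Setting. Let $n,m$ be positive integers, and let $A:\mathbb{R}^n\to\mathbb{R}^{n\times n}$ be of the form $A(v)=\sum_{i=1}^m f_i(v)A_i$, where each $A_i\in\mathbb{R}^{n\times n}$ is symmetric and each $f_i:\mathbb{R}^n\to\mathbb{R}$ is scaling invariant, i.e. $f_i(\alpha x)=f_i(x)$ for all $x\in\mathbb{R}^n$ and $\alpha\in\mathbb{R}\setminus\{0\}$, and continuously differentiable on $\mathbb{R}^n\setminus\{0\}$. Hence $A(v)$ is symmetric, $A(\alpha x)=A(x)$ for $\alpha\ne0$, and $A$ is continuously differentiable on $\mathbb{R}^n\setminus\{0\}$. An eigenpair is $(\lambda,v)\in\mathbb{R}\times(\mathbb{R}^n\setminus\{0\})$ with $A(v)v=\lambda v$. The Jacobian is $J(v):=\frac{\partial}{\partial v}\left(A(v)v\right)\in\mathbb{R}^{n\times n}$. (By scaling invariance $J(v)v=A(v)v$, so $v$ is an eigenvector of $J(v)$ with eigenvalue $\lambda$.) The eigenpair $(\lambda,v)$ is called simple if $\lambda$ is a simple (algebraic multiplicity one) eigenvalue of the matrix $J(v)$ with eigenvector $v$. Perturbations. Fix matrices $E_1,\dots,E_m\in\mathbb{R}^{n\times n}$. For a simple eigenpair $(\lambda,v)$ with $\frac12v^Tv=1$, the implicit function theorem gives an open set $\mathcal U\subset\mathbb{R}$ containing $0$ and unique differentiable functions $\lambda(\varepsilon),v(\varepsilon)$ on $\mathcal U$ with $\lambda(0)=\lambda$, $v(0)=v$ and, for all $\varepsilon\in\mathcal U$, $$\Big(A(v(\varepsilon))+\varepsilon\sum_{i=1}^m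 f_i(v(\varepsilon))E_i\Big)v(\varepsilon)=\lambda(\varepsilon)v(\varepsilon),\qquad \tfrac12 v(\varepsilon)^Tv(\varepsilon)=1 .$$ Write $\lambda'=\lambda'(0)$ (it depends on $E_1,\dots,E_m$). Definitions. Given weights $w_i\ge0$, $$\kappa(\lambda)=\sup\left\{\frac{|\lambda'|}{|\lambda|}:\ E_i\in\mathbb{R}^{n\times n},\ \|E_i\|\le w_i,\ i=1,\dots,m\right\},$$ where the matrix norm is either the spectral norm or the Frobenius norm, and $$\kappa_{\mathrm{sym}}^{( * )}(\lambda)=\sup\left\{\frac{|\lambda'|}{|\lambda|}:\ E_i\in\mathbb{R}^{n\times n},\ \|E_i\|_*\le w_i,\ E_i=E_i^T,\ i=1,\dots,m\right\},$$ where $*=2$ denotes the spectral norm and $*=F$ the Frobenius norm. For vectors, $\|\cdot\|$ is the Euclidean norm. *)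

theory Defs
  imports "HOL-Analysis.Analysis" "HOL-Computational_Algebra.Polynomial"
begin

definition spectral_norm :: "real^'n^'n \<Rightarrow> real" where
  "spectral_norm M = onorm (\<lambda>x. M *v x)"

definition frobenius_norm :: "real^'n^'n \<Rightarrow> real" where
  "frobenius_norm M = sqrt (\<Sum>i\<in>UNIV. \<Sum>j\<in>UNIV. (M $ i $ j)\<^sup>2)"

definition charpoly :: "real^'n^'n \<Rightarrow> real poly" where
  "charpoly M = det (\<chi> i j. (if i = j then [:0, 1:] else 0) - [:M $ i $ j:])"

definition scaling_invariant :: "(real^'n \<Rightarrow> real) \<Rightarrow> bool" where
  "scaling_invariant g \<longleftrightarrow> (\<forall>x a. a \<noteq> 0 \<longrightarrow> g (a *\<^sub>R x) = g x)"

definition continuously_differentiable_on :: "(real^'n) set \<Rightarrow> (real^'n \<Rightarrow> real) \<Rightarrow> bool" where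
  "continuously_differentiable_on S g \<longleftrightarrow>
     (\<exists>g' :: real^'n \<Rightarrow> (real^'n) \<Rightarrow>\<^sub>L real.
        (\<forall>x\<in>S. (g has_derivative blinfun_apply (g' x)) (at x)) \<and> continuous_on S g')"

definition combination :: "('m::finite \<Rightarrow> real^'n \<Rightarrow> real) \<Rightarrow> ('m \<Rightarrow> real^'n^'n) \<Rightarrow> real^'n \<Rightarrow> real^'n^'n" where
  "combination f A x = (\<Sum>i\<in>UNIV. f i x *\<^sub>R A i)"

definition eigenpair :: "('m::finite \<Rightarrow> real^'n \<Rightarrow> real) \<Rightarrow> ('m \<Rightarrow> real^'n^'n) \<Rightarrow> real \<Rightarrow> real^'n \<Rightarrow> bool" where
  "eigenpair f A l v \<longleftrightarrow> v \<noteq> 0 \<and> combination f A v *v v = l *\<^sub>R v"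

definition J :: "('m::finite \<Rightarrow> real^'n \<Rightarrow> real) \<Rightarrow> ('m \<Rightarrow> real^'n^'n) \<Rightarrow> real^'n \<Rightarrow> real^'n^'n" where
  "J f A v = jacobian (\<lambda>x. combination f A x *v x) (at v)"

definition simple_eigenpair :: "('m::finite \<Rightarrow> real^'n \<Rightarrow> real) \<Rightarrow> ('m \<Rightarrow> real^'n^'n) \<Rightarrow> real \<Rightarrow> real^'n \<Rightarrow> bool" where
  "simple_eigenpair f A l v \<longleftrightarrow>
     eigenpair f A l v \<and> J f A v *v v = l *\<^sub>R v \<and> order l (charpoly (J f A v)) = 1"

definition perturbation_branch ::
  "('m::finite \<Rightarrow> real^'n \<Rightarrow> real) \<Rightarrow> ('m \<Rightarrow> real^'n^'n) \<Rightarrow> ('m \<Rightarrow> real^'n^'n) \<Rightarrow> real \<Rightarrow> real^'n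
    \<Rightarrow> real set \<Rightarrow> (real \<Rightarrow> real) \<Rightarrow> (real \<Rightarrow> real^'n) \<Rightarrow> bool" where
  "perturbation_branch f A E l v U lc vc \<longleftrightarrow>
     open U \<and> 0 \<in> U \<and> lc differentiable_on U \<and> vc differentiable_on U \<and>
     lc 0 = l \<and> vc 0 = v \<and>
     (\<forall>\<epsilon>\<in>U. (combination f A (vc \<epsilon>) + \<epsilon> *\<^sub>R combination f E (vc \<epsilon>)) *v vc \<epsilon> = lc \<epsilon> *\<^sub>R vc \<epsilon> \<and>
            (1/2) * (vc \<epsilon> \<bullet> vc \<epsilon>) = 1)"

text \<open>The number \<open>\<lambda>'(0)\<close>. At a normalized simple eigenpair the implicit function theorem provides
  a branch, and any two branches agree near \<open>0\<close>, so that the description is proper there.\<close>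

definition eigenvalue_deriv ::
  "('m::finite \<Rightarrow> real^'n \<Rightarrow> real) \<Rightarrow> ('m \<Rightarrow> real^'n^'n) \<Rightarrow> ('m \<Rightarrow> real^'n^'n) \<Rightarrow> real \<Rightarrow> real^'n \<Rightarrow> real" where
  "eigenvalue_deriv f A E l v =
     (THE d. \<exists>U lc vc. perturbation_branch f A E l v U lc vc \<and> (lc has_real_derivative d) (at 0))"

text \<open>The suprema are taken in \<^typ>\<open>ereal\<close>, so that they need no boundedness side condition.
  The first argument is the norm that measures the perturbations.\<close>

definition kappa ::
  "(real^'n^'n \<Rightarrow> real) \<Rightarrow> ('m::finite \<Rightarrow> real^'n \<Rightarrow> real) \<Rightarrow> ('m \<Rightarrow> real^'n^'n) \<Rightarrow> ('m \<Rightarrow> real)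
    \<Rightarrow> real \<Rightarrow> real^'n \<Rightarrow> ereal" where
  "kappa N f A w l v =
     (SUP E \<in> {E. \<forall>i. N (E i) \<le> w i}. ereal (\<bar>eigenvalue_deriv f A E l v\<bar> / \<bar>l\<bar>))"

definition kappa_sym ::
  "(real^'n^'n \<Rightarrow> real) \<Rightarrow> ('m::finite \<Rightarrow> real^'n \<Rightarrow> real) \<Rightarrow> ('m \<Rightarrow> real^'n^'n) \<Rightarrow> ('m \<Rightarrow> real)
    \<Rightarrow> real \<Rightarrow> real^'n \<Rightarrow> ereal" where
  "kappa_sym N f A w l v =
     (SUP E \<in> {E. \<forall>i. N (E i) \<le> w i \<and> transpose (E i) = E i}.
        ereal (\<bar>eigenvalue_deriv f A E l v\<bar> / \<bar>l\<bar>))"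

end

theory Submission
  imports Defs
begin

text \<open>Differentiating the perturbed equation at \<open>0\<close> and multiplying by the left eigenvector gives
  \<open>\<lambda>' (u \<bullet> v) = \<Sum>i. f i v * (u \<bullet> (E i *v v))\<close>. Simplicity of the eigenvalue makes the bordered
  linear map \<open>(h, m) \<mapsto> (J h - \<lambda> h - m v, v \<bullet> h)\<close> injective, which yields both \<open>u \<bullet> v \<noteq> 0\<close> and the
  existence of the branch, by the inverse function theorem for \<open>(v, \<lambda>, \<epsilon>) \<mapsto> (residual, v \<bullet> v / 2, \<epsilon>)\<close>.
  All condition numbers are therefore the same multiple of the maximum of \<open>u \<bullet> (M *v v)\<close> over the
  admissible matrices of norm at most \<open>1\<close>. Without the symmetry constraint this is \<open>norm u * norm v\<close>,
  attained at a multiple of \<open>u v\<^sup>T\<close>; a reflection attains the same value among symmetric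
  matrices of spectral norm \<open>1\<close>. For the Frobenius norm, symmetric matrices only see the symmetric
  part of \<open>u v\<^sup>T\<close>, whose norm is smaller by the factor \<open>\<beta>\<close>.\<close>

subsection \<open>Simple eigenvalues and the bordered system\<close>

text \<open>The modified matrix of Cramer's rule, kept as a function so that two replacements can be
  nested.\<close>

definition replace_column :: "'n \<Rightarrow> 'a^'n \<Rightarrow> 'a^'n^'n \<Rightarrow> 'a^'n^'n" where
  "replace_column k y M = (\<chi> i j. if j = k then y $ i else M $ i $ j)"

lemma det_replace_column_scale:
  fixes M :: "'a::comm_ring_1^'n^'n"
  shows "det (replace_column k (s *s y) M) = s * det (replace_column k y M)"
proof -
  have "det (replace_column k (s *s y) M) = det (transpose (replace_column k (s *s y) M))"
    by simp
  also have "transpose (replace_column k (s *s y) M) = (\<chi> i. if i = k then s *s y else column i M)"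
    by (simp add: replace_column_def transpose_def column_def vec_eq_iff)
  also have "det \<dots> = s * det (\<chi> i. if i = k then y else column i M)"
    by (rule det_row_mul)
  also have "(\<chi> i. if i = k then y else column i M) = transpose (replace_column k y M)"
    by (simp add: replace_column_def transpose_def column_def vec_eq_iff)
  finally show ?thesis
    by simp
qed

text \<open>Cramer's rule without invertibility: when \<open>M\<close> maps \<open>x\<close> to a
  multiple of \<open>y\<close>, the scalar comes out of the determinant.\<close>

lemma det_replace_column:
  fixes M :: "'a::field^'n^'n"
  assumes "M *v x = s *s y"
  shows "x $ k * det M = s * det (replace_column k y M)"
  using cramer_lemma[of k M x] det_replace_column_scale[of k s y M]
  unfolding assms replace_column_def by simp

text \<open>A vector with vanishing entry \<open>k\<close> does not see column \<open>k\<close>,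
  while \<open>axis k 1\<close> sees only that column. This and the next lemma evaluate a modified
  matrix on a sum of the two.\<close>

lemma replace_column_mult:
  fixes M :: "'a::comm_ring_1^'n^'n"
  assumes "x $ k = 0"
  shows "replace_column k y M *v x = M *v x"
  using assms by (auto simp: replace_column_def matrix_vector_mult_def vec_eq_iff intro!: sum.cong)

lemma replace_column_axis:
  fixes M :: "'a::comm_ring_1^'n^'n"
  shows "replace_column k y M *v (m *s axis k 1) = m *s y"
  by (simp add: replace_column_def matrix_vector_mult_def vec_eq_iff axis_def if_distrib
      mult.commute cong: if_cong)

section \<open>The characteristic polynomial and the multiplicity of its roots\<close>

lemma poly_charpoly: "poly (charpoly M) t = det (mat t - M)"
proof -
  \<comment> \<open>Permutation signs enter \<open>det\<close> through \<open>of_int\<close>; over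
    polynomials they are constants, which evaluation preserves.\<close>
  have "of_int k = [:of_int k :: real:]" for k
    by (simp add: of_int_poly)
  then show ?thesis
    unfolding charpoly_def det_def poly_sum poly_mult poly_prod
    by (intro sum.cong refl arg_cong2[where f = "(*)"] prod.cong) (auto simp: mat_def)
qed

text \<open>A number above the operator norm is no eigenvalue, so the polynomial does not vanish
  there. Splitting off the root factor by \<open>order_decomp\<close> requires this.\<close>

lemma charpoly_nonzero:
  fixes M :: "real^'n^'n"
  shows "charpoly M \<noteq> 0"
proof
  assume 0: "charpoly M = 0"
  define t where "t = onorm ((*v) M) + 1"
  have "x = 0" if "(mat t - M) *v x = 0" for x :: "real^'n"
  proof (rule ccontr)
    assume "x \<noteq> 0"
    have "mat t *v x = t *\<^sub>R x"
      by (simp add: mat_def matrix_vector_mult_def vec_eq_iff if_distrib if_distribR cong: if_cong)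
    with that have "M *v x = t *\<^sub>R x"
      by (simp add: matrix_vector_mult_diff_rdistrib)
    then have "\<bar>t\<bar> * norm x \<le> onorm ((*v) M) * norm x"
      using onorm[OF matrix_vector_mul_bounded_linear, of M x] by simp
    with \<open>x \<noteq> 0\<close> show False
      by (simp add: t_def)
  qed
  then have "det (mat t - M) \<noteq> 0"
    by (metis invertible_det_nz invertible_left_inverse matrix_left_invertible_ker)
  then show False
    using poly_charpoly[of M t] 0 by simp
qed

lemma continuous_on_det:
  fixes M :: "'a::topological_space \<Rightarrow> real^'n^'n"
  assumes "\<And>i j. continuous_on S (\<lambda>x. M x $ i $ j)"
  shows "continuous_on S (\<lambda>x. det (M x))"
  unfolding det_def by (intro continuous_intros assms)

text \<open>Two column replacements extract the factor \<open>t - l\<close> twice from \<open>det (mat t - M)\<close>.\<close>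

lemma order_charpoly_neq_1:
  fixes M :: "real^'n^'n"
  assumes v: "M *v v = l *s v" "v \<noteq> 0"
    and h: "M *v h = l *s h + m *s v" "\<And>c. h \<noteq> c *s v"
  shows "order l (charpoly M) \<noteq> 1"
proof
  assume ord: "order l (charpoly M) = 1"
  obtain j where j: "v $ j \<noteq> 0"
    using v(2) by (auto simp: vec_eq_iff)
  \<comment> \<open>Subtracting a multiple of \<open>v\<close> clears entry \<open>j\<close> but
    keeps the relation satisfied by \<open>h\<close>, so replacing column \<open>j\<close> will not
    affect \<open>h'\<close>.\<close>
  define h' where "h' = h - (h $ j / v $ j) *s v"
  have h'j: "h' $ j = 0"
    using j by (simp add: h'_def)
  have "h' \<noteq> 0"
    using h(2) by (simp add: h'_def)
  then obtain k where k: "h' $ k \<noteq> 0"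
    by (auto simp: vec_eq_iff)
  with h'j have "k \<noteq> j" by auto
  define g where "g t = det (replace_column k h' (replace_column j v (mat t - M)))" for t
  have fact: "h' $ k * v $ j * poly (charpoly M) t = (t - l)\<^sup>2 * g t" for t
  proof -
    let ?C = "mat t - M"
    have mat: "mat t *v x = t *s x" for x :: "real^'n"
      by (simp add: mat_def matrix_vector_mult_def vec_eq_iff if_distrib if_distribR cong: if_cong)
    have "?C *v v = (t - l) *s v"
      by (simp add: matrix_vector_mult_diff_rdistrib v mat vec_eq_iff algebra_simps)
    then have 1: "v $ j * det ?C = (t - l) * det (replace_column j v ?C)"
      by (rule det_replace_column)
    have "M *v h' = l *s h' + m *s v"
      unfolding h'_def matrix_vector_mult_diff_distrib vector_scalar_commute v h
      by (simp add: vec_eq_iff algebra_simps)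
    then have "?C *v h' = (t - l) *s h' - m *s v"
      by (simp add: matrix_vector_mult_diff_rdistrib mat vec_eq_iff algebra_simps)
    \<comment> \<open>Column \<open>j\<close> is now \<open>v\<close>, so the summand
      \<open>m *s axis j 1\<close> contributes \<open>m *s v\<close> and cancels the defect in the
      image of \<open>h'\<close>.\<close>
    then have "replace_column j v ?C *v (h' + m *s axis j 1) = (t - l) *s h'"
      by (simp only: matrix_vector_right_distrib replace_column_mult[of h' j, OF h'j]
          replace_column_axis) simp
    then have "(h' + m *s axis j 1) $ k * det (replace_column j v ?C) = (t - l) * g t"
      unfolding g_def by (rule det_replace_column)
    then have 2: "h' $ k * det (replace_column j v ?C) = (t - l) * g t"
      using \<open>k \<noteq> j\<close> by (simp add: axis_def)
    have "h' $ k * v $ j * det ?C = (t - l) * (h' $ k * det (replace_column j v ?C))"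
      using 1 by simp
    then show ?thesis
      unfolding 2 poly_charpoly by (simp add: power2_eq_square)
  qed
  have "charpoly M \<noteq> 0"
    by (rule charpoly_nonzero)
  from order_decomp[OF this, of l] obtain q
    where q: "charpoly M = [:- l, 1:] * q" "\<not> [:- l, 1:] dvd q"
    unfolding ord by auto
  have eq: "h' $ k * v $ j * poly q t = (t - l) * g t" if "t \<noteq> l" for t
  proof -
    have "(t - l) * (h' $ k * v $ j * poly q t) = (t - l) * ((t - l) * g t)"
      using fact[of t] by (simp add: q(1) power2_eq_square algebra_simps)
    then show ?thesis
      using that by simp
  qed
  \<comment> \<open>Cancelling \<open>t - l\<close> lost the point \<open>l\<close>. Continuity of
    \<open>g\<close> recovers it and makes \<open>l\<close> a root of \<open>q\<close>, against
    multiplicity one.\<close>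
  have "continuous_on UNIV g"
    unfolding g_def
  proof (rule continuous_on_det)
    fix i j'
    show "continuous_on UNIV (\<lambda>t. replace_column k h' (replace_column j v (mat t - M)) $ i $ j')"
      by (cases "j' = k"; cases "j' = j"; cases "i = j'";
          simp add: replace_column_def mat_def continuous_intros)
  qed
  then have "isCont g l"
    by (simp add: continuous_on_eq_continuous_at)
  then have "((\<lambda>t. (t - l) * g t) \<longlongrightarrow> (l - l) * g l) (at l)"
    by (intro tendsto_intros) (simp add: isCont_def)
  moreover have "((\<lambda>t. h' $ k * v $ j * poly q t) \<longlongrightarrow> h' $ k * v $ j * poly q l) (at l)"
    by (intro tendsto_intros)
  then have "((\<lambda>t. (t - l) * g t) \<longlongrightarrow> h' $ k * v $ j * poly q l) (at l)"
    by (rule Lim_transform_eventually) (simp add: eq eventually_at_filter)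
  ultimately have "h' $ k * v $ j * poly q l = (l - l) * g l"
    using LIM_unique by blast
  with j k q(2) show False
    by (simp add: poly_eq_0_iff_dvd)
qed

text \<open>A nonzero \<open>h\<close> orthogonal to \<open>v\<close> is independent of
  \<open>v\<close>: it would be a second eigenvector if \<open>m = 0\<close> and a generalized one
  otherwise. Neither is compatible with multiplicity one.\<close>

lemma bordered_injective:
  fixes M :: "real^'n^'n"
  assumes v: "M *v v = l *\<^sub>R v" "v \<noteq> 0" and ord: "order l (charpoly M) = 1"
    and h: "M *v h - l *\<^sub>R h - m *\<^sub>R v = 0" "v \<bullet> h = 0"
  shows "h = 0 \<and> m = 0"
proof -
  have Mh: "M *v h = l *s h + m *s v"
    using h(1) by (simp add: scalar_mult_eq_scaleR algebra_simps)
  have "h = 0"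
  proof (rule ccontr)
    assume "h \<noteq> 0"
    have "h \<noteq> c *s v" for c
      using h(2) v(2) \<open>h \<noteq> 0\<close> by (auto simp: scalar_mult_eq_scaleR)
    then show False
      using order_charpoly_neq_1[of M v l h m] v Mh ord by (simp add: scalar_mult_eq_scaleR)
  qed
  then show ?thesis
    using h v(2) by simp
qed

text \<open>By dimension the injective bordered map is onto and attains \<open>(u, 0)\<close>.
  Pairing the first component with \<open>u\<close> kills the range of \<open>M - l\<close> and,
  under orthogonality, also the multiple of \<open>v\<close>, leaving
  \<open>u \<bullet> u = 0\<close>.\<close>

lemma left_eigenvector_not_orthogonal:
  fixes M :: "real^'n^'n"
  assumes v: "M *v v = l *\<^sub>R v" "v \<noteq> 0" and ord: "order l (charpoly M) = 1"
    and u: "u v* M = l *\<^sub>R u" "u \<noteq> 0"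
  shows "u \<bullet> v \<noteq> 0"
proof
  assume uv: "u \<bullet> v = 0"
  define L where "L = (\<lambda>(h, m). (M *v h - l *\<^sub>R h - m *\<^sub>R v, v \<bullet> h))"
  have lin: "linear L"
    unfolding L_def
    by (rule linearI) (auto simp: algebra_simps matrix_vector_right_distrib inner_add_right
        matrix_vector_mult_scaleR)
  have "inj L"
    unfolding linear_injective_0[OF lin]
    using bordered_injective[OF v ord] by (auto simp: L_def zero_prod_def)
  then have "surj L"
    using linear_injective_imp_surjective[OF lin] by simp
  then obtain h m where "L (h, m) = (u, 0)"
    by (metis surjE prod.exhaust_sel)
  then have "u \<bullet> u = u \<bullet> (M *v h - l *\<^sub>R h - m *\<^sub>R v)"
    by (simp add: L_def)
  also have "\<dots> = (u v* M) \<bullet> h - l * (u \<bullet> h) - m * (u \<bullet> v)"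
    by (simp add: inner_diff_right dot_lmul_matrix)
  also have "\<dots> = 0"
    by (simp add: u uv)
  finally show False
    using u(2) by simp
qed

subsection \<open>The perturbation branch\<close>

lemma combination_mult: "combination f A x *v y = (\<Sum>i\<in>UNIV. f i x *\<^sub>R (A i *v y))"
proof -
  have "combination f A x *v y = (\<Sum>i\<in>UNIV. (f i x *\<^sub>R A i) *v y)"
    unfolding combination_def
    by (simp add: vec_eq_iff matrix_vector_mult_def sum_distrib_right sum.swap[where A = "UNIV :: 'a set"])
  then show ?thesis
    by (simp add: scaleR_matrix_vector_assoc)
qed

lemma combination_has_derivative:
  fixes g' :: "'m::finite \<Rightarrow> real^'n \<Rightarrow> (real^'n) \<Rightarrow>\<^sub>L real"
  assumes "\<And>i. (f i has_derivative blinfun_apply (g' i x)) (at x)"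
  shows "((\<lambda>x. combination f A x *v x) has_derivative
    (\<lambda>h. \<Sum>i\<in>UNIV. g' i x h *\<^sub>R (A i *v x) + f i x *\<^sub>R (A i *v h))) (at x)"
proof -
  have "((\<lambda>x. A i *v x) has_derivative (\<lambda>h. A i *v h)) (at x)" for i
    by (rule bounded_linear_imp_has_derivative) simp
  then have "((\<lambda>x. f i x *\<^sub>R (A i *v x)) has_derivative
      (\<lambda>h. f i x *\<^sub>R (A i *v h) + g' i x h *\<^sub>R (A i *v x))) (at x)" for i
    by (intro has_derivative_scaleR assms)
  from has_derivative_sum[of UNIV, OF this] show ?thesis
    unfolding combination_mult by (simp add: add.commute)
qed

text \<open>\<open>jacobian\<close> represents the derivative only where the map is differentiable;
  smoothness of the \<open>f i\<close> away from the origin supplies this.\<close>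

lemma J_has_derivative:
  assumes "\<And>i. continuously_differentiable_on (- {0}) (f i)" "v \<noteq> 0"
  shows "((\<lambda>x. combination f A x *v x) has_derivative (\<lambda>h. J f A v *v h)) (at v)"
proof -
  have "\<forall>i. \<exists>g'. (f i has_derivative blinfun_apply g') (at v)"
    using assms unfolding continuously_differentiable_on_def by blast
  then obtain g' where g': "\<And>i. (f i has_derivative blinfun_apply (g' i)) (at v)"
    by metis
  have "(\<lambda>x. combination f A x *v x) differentiable (at v)"
    using combination_has_derivative[of f "\<lambda>i _. g' i", OF g'] by (rule differentiableI)
  then show ?thesis
    unfolding J_def by (simp add: jacobian_works)
qed

text \<open>The argument is the triple (eigenvector, eigenvalue, eps). Copying eps into the last
  component equalizes the dimensions, so that the inverse function theorem can act as an implicit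
  function theorem.\<close>

definition bordered_map ::
  "('m::finite \<Rightarrow> real^'n \<Rightarrow> real) \<Rightarrow> ('m \<Rightarrow> real^'n^'n) \<Rightarrow> ('m \<Rightarrow> real^'n^'n) \<Rightarrow>
    (real^'n) \<times> real \<times> real \<Rightarrow> (real^'n) \<times> real \<times> real" where
  "bordered_map f A E z =
    (combination f A (fst z) *v fst z + snd (snd z) *\<^sub>R (combination f E (fst z) *v fst z)
       - fst (snd z) *\<^sub>R fst z,
     (1/2) * (fst z \<bullet> fst z), snd (snd z))"

text \<open>The derivative of \<open>bordered_map\<close> at \<open>z\<close> in direction
  \<open>k\<close>, with \<open>g' i\<close> standing for the derivative of
  \<open>f i\<close>.\<close>

definition bordered_deriv ::
  "('m::finite \<Rightarrow> real^'n \<Rightarrow> real) \<Rightarrow> ('m \<Rightarrow> real^'n \<Rightarrow> (real^'n) \<Rightarrow>\<^sub>L real) \<Rightarrow>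
    ('m \<Rightarrow> real^'n^'n) \<Rightarrow> ('m \<Rightarrow> real^'n^'n) \<Rightarrow>
    (real^'n) \<times> real \<times> real \<Rightarrow> (real^'n) \<times> real \<times> real \<Rightarrow> (real^'n) \<times> real \<times> real" where
  "bordered_deriv f g' A E z k =
    ((\<Sum>i\<in>UNIV. g' i (fst z) (fst k) *\<^sub>R (A i *v fst z) + f i (fst z) *\<^sub>R (A i *v fst k))
       + (snd (snd z) *\<^sub>R
           (\<Sum>i\<in>UNIV. g' i (fst z) (fst k) *\<^sub>R (E i *v fst z) + f i (fst z) *\<^sub>R (E i *v fst k))
         + snd (snd k) *\<^sub>R (combination f E (fst z) *v fst z))
       - (fst (snd z) *\<^sub>R fst k + fst (snd k) *\<^sub>R fst z),
     fst z \<bullet> fst k, snd (snd k))"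

lemma bordered_map_has_derivative:
  assumes g': "\<And>i. (f i has_derivative blinfun_apply (g' i (fst z))) (at (fst z))"
  shows "(bordered_map f A E has_derivative bordered_deriv f g' A E z) (at z)"
proof -
  have comb: "((\<lambda>z. combination f B (fst z) *v fst z) has_derivative
      (\<lambda>k. \<Sum>i\<in>UNIV. g' i (fst z) (fst k) *\<^sub>R (B i *v fst z) + f i (fst z) *\<^sub>R (B i *v fst k))) (at z)"
    for B
    by (rule has_derivative_compose[OF has_derivative_fst[OF has_derivative_ident]
          combination_has_derivative[of f g' "fst z" B, OF g']])
  show ?thesis
    unfolding bordered_map_def[abs_def] bordered_deriv_def[abs_def]
    by (rule comb derivative_eq_intros refl)+ (auto simp: fun_eq_iff inner_commute)
qed

text \<open>The branch is a local inverse of \<open>bordered_map\<close>, restricted to the line of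
  values with zero residual, half squared norm 1 and free eps.\<close>

lemma perturbation_branch_exists:
  fixes f :: "'m::finite \<Rightarrow> real^'n \<Rightarrow> real"
  assumes smooth: "\<And>i. continuously_differentiable_on (- {0}) (f i)"
    and simple: "simple_eigenpair f A l v" and normalized: "(1/2) * (v \<bullet> v) = 1"
  shows "\<exists>U lc vc. perturbation_branch f A E l v U lc vc"
proof -
  have v: "v \<noteq> 0" "combination f A v *v v = l *\<^sub>R v" "J f A v *v v = l *\<^sub>R v"
    and ord: "order l (charpoly (J f A v)) = 1"
    using simple by (auto simp: simple_eigenpair_def eigenpair_def)
  obtain g' where g': "\<And>i x. x \<noteq> 0 \<Longrightarrow> (f i has_derivative blinfun_apply (g' i x)) (at x)"
    and g'_cont: "\<And>i. continuous_on (- {0}) (g' i)"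
    using smooth unfolding continuously_differentiable_on_def by (simp add: Ball_def) metis
  define W :: "((real^'n) \<times> real \<times> real) set" where "W = fst -` (- {0})"
  have "open W"
    unfolding W_def by (intro open_vimage continuous_intros)
  define F where "F = bordered_map f A E"
  define D where "D z = Blinfun (bordered_deriv f g' A E z)" for z
  have deriv: "(F has_derivative bordered_deriv f g' A E z) (at z)" if "z \<in> W" for z
    unfolding F_def using that by (intro bordered_map_has_derivative g') (simp add: W_def)
  have D: "blinfun_apply (D z) = bordered_deriv f g' A E z" if "z \<in> W" for z
    unfolding D_def
    by (rule bounded_linear_Blinfun_apply) (rule has_derivative_bounded_linear[OF deriv[OF that]])
  have f_cont: "continuous_on (- {0}) (f i)" for i
    using g' by (intro continuous_at_imp_continuous_on ballI has_derivative_continuous) auto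
  \<comment> \<open>In finite dimensions, continuity of an operator-valued map can be checked on
    each fixed vector.\<close>
  have D_cont: "continuous_on W D"
  proof (rule continuous_on_blinfun_componentwise)
    fix k :: "(real^'n) \<times> real \<times> real"
    have fst_cont: "continuous_on W fst" and fst_W: "fst ` W \<subseteq> - {0}"
      by (auto simp: W_def intro!: continuous_intros)
    have [continuous_intros]: "continuous_on W (\<lambda>z. f i (fst z))" for i
      using continuous_on_compose2[OF f_cont fst_cont fst_W] .
    have [continuous_intros]: "continuous_on W (\<lambda>z. g' i (fst z) (fst k))" for i
      by (rule bounded_linear.continuous_on[OF blinfun.bounded_linear_left
            continuous_on_compose2[OF g'_cont fst_cont fst_W]])
    have [continuous_intros]: "continuous_on W (\<lambda>z. M *v fst z)" for M :: "real^'n^'n"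
      using continuous_on_compose2[OF matrix_vector_mult_linear_continuous_on[of UNIV M] fst_cont]
      by simp
    have "continuous_on W (\<lambda>z. bordered_deriv f g' A E z k)"
      unfolding bordered_deriv_def combination_mult by (intro continuous_intros)
    then show "continuous_on W (\<lambda>z. D z k)"
      by (rule continuous_on_eq) (simp add: D)
  qed
  define z0 :: "(real^'n) \<times> real \<times> real" where "z0 = (v, l, 0)"
  have z0: "z0 \<in> W"
    using v by (simp add: z0_def W_def)
  have Fz0: "F z0 = (0, 1, 0)"
    using v(2) normalized by (simp add: F_def z0_def bordered_map_def)
  let ?L = "bordered_deriv f g' A E z0"
  have lin: "linear ?L"
    using has_derivative_bounded_linear[OF deriv[OF z0]] by (rule bounded_linear.linear)
  \<comment> \<open>Uniqueness of the derivative identifies \<open>J f A v\<close> with the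
    product-rule sum inside \<open>?L\<close>.\<close>
  have Jh: "J f A v *v h = (\<Sum>i\<in>UNIV. g' i v h *\<^sub>R (A i *v v) + f i v *\<^sub>R (A i *v h))" for h
    using has_derivative_unique[OF J_has_derivative[OF smooth v(1)]
        combination_has_derivative[of f g' v, OF g'[OF v(1)]]] by metis
  have "inj ?L"
    unfolding linear_injective_0[OF lin]
  proof (intro allI impI)
    \<comment> \<open>The last component forces the eps direction to vanish, and eps is 0 at
      \<open>z0\<close>, so only the bordered system of \<open>J f A v\<close> remains.\<close>
    fix k assume "?L k = 0"
    then have k: "J f A v *v fst k - l *\<^sub>R fst k - fst (snd k) *\<^sub>R v = 0" "v \<bullet> fst k = 0"
        "snd (snd k) = 0"
      by (auto simp: bordered_deriv_def z0_def zero_prod_def diff_diff_eq simp flip: Jh)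
    with bordered_injective[OF v(3,1) ord k(1,2)] show "k = 0"
      by (simp add: prod_eq_iff)
  qed
  then obtain L' where L': "linear L'" "L' \<circ> ?L = id"
    using linear_injective_left_inverse[OF lin] by blast
  have "L' (?L k) = k" for k
    using L'(2) by (metis comp_apply id_apply)
  then have "Blinfun L' o\<^sub>L D z0 = id_blinfun"
    using L'(1) by (intro blinfun_eqI)
      (simp add: bounded_linear_Blinfun_apply linear_conv_bounded_linear D[OF z0])
  then obtain W' V G G' where W': "open W'" "W' \<subseteq> W" "z0 \<in> W'"
    and V: "open V" "F z0 \<in> V" and hom: "homeomorphism W' V F G"
    and G': "\<And>y. y \<in> V \<Longrightarrow> (G has_derivative (G' y)) (at y)"
    using inverse_function_theorem[OF \<open>open W\<close>, of F D z0 "Blinfun L'"] deriv D D_cont z0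
    by metis
  define c :: "real \<Rightarrow> (real^'n) \<times> real \<times> real" where "c \<epsilon> = (0, 1, \<epsilon>)" for \<epsilon>
  define U where "U = c -` V"
  have "open U"
    unfolding U_def c_def by (intro open_vimage V continuous_intros)
  have U0: "0 \<in> U"
    using V(2) by (simp add: U_def c_def Fz0)
  have "(\<lambda>\<epsilon>. G (c \<epsilon>)) differentiable (at \<epsilon>)" if "\<epsilon> \<in> U" for \<epsilon>
  proof -
    have "c differentiable (at \<epsilon>)"
      unfolding c_def[abs_def] by (intro differentiable_Pair) simp_all
    moreover have "G differentiable (at (c \<epsilon>))"
      using G'[of "c \<epsilon>"] that unfolding U_def by (blast intro: differentiableI)
    ultimately show ?thesis
      using differentiable_chain_at[of c \<epsilon> G] by (simp add: o_def)
  qed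
  then have diff: "(\<lambda>\<epsilon>. G (c \<epsilon>)) differentiable_on U"
    by (simp add: differentiable_at_imp_differentiable_on)
  have FG: "F (G (c \<epsilon>)) = (0, 1, \<epsilon>)" if "\<epsilon> \<in> U" for \<epsilon>
    using that hom by (simp add: U_def c_def homeomorphism_def)
  have G0: "G (c 0) = (v, l, 0)"
    using hom W'(3) Fz0 by (metis c_def homeomorphism_def z0_def)
  have "perturbation_branch f A E l v U (\<lambda>\<epsilon>. fst (snd (G (c \<epsilon>)))) (\<lambda>\<epsilon>. fst (G (c \<epsilon>)))"
    unfolding perturbation_branch_def
  proof (intro conjI ballI)
    show "(\<lambda>\<epsilon>. fst (snd (G (c \<epsilon>)))) differentiable_on U"
      using diff unfolding differentiable_on_def differentiable_def
      by (fast dest: has_derivative_fst[OF has_derivative_snd])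
    show "(\<lambda>\<epsilon>. fst (G (c \<epsilon>))) differentiable_on U"
      using diff unfolding differentiable_on_def differentiable_def
      by (fast dest: has_derivative_fst)
    fix \<epsilon> assume "\<epsilon> \<in> U"
    from FG[OF this] show "(combination f A (fst (G (c \<epsilon>))) + \<epsilon> *\<^sub>R combination f E (fst (G (c \<epsilon>)))) *v
        fst (G (c \<epsilon>)) = fst (snd (G (c \<epsilon>))) *\<^sub>R fst (G (c \<epsilon>))"
      and "(1/2) * (fst (G (c \<epsilon>)) \<bullet> fst (G (c \<epsilon>))) = 1"
      by (auto simp: F_def bordered_map_def matrix_vector_mult_add_rdistrib
          scaleR_matrix_vector_assoc)
  qed (simp_all add: \<open>open U\<close> U0 G0)
  then show ?thesis
    by blast
qed

text \<open>The derivative of the eigenvector along the branch is unknown, but pairing with the left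
  eigenvector cancels it from both sides.\<close>

lemma perturbation_branch_deriv:
  fixes f :: "'m::finite \<Rightarrow> real^'n \<Rightarrow> real"
  assumes smooth: "\<And>i. continuously_differentiable_on (- {0}) (f i)" and v: "v \<noteq> 0"
    and u: "u v* J f A v = l *\<^sub>R u"
    and branch: "perturbation_branch f A E l v U lc vc" and d: "(lc has_real_derivative d) (at 0)"
  shows "d * (u \<bullet> v) = u \<bullet> (combination f E v *v v)"
proof -
  have U: "open U" "0 \<in> U" and vc: "vc differentiable_on U" and at_0: "lc 0 = l" "vc 0 = v"
    and eq: "\<And>\<epsilon>. \<epsilon> \<in> U \<Longrightarrow> combination f A (vc \<epsilon>) *v vc \<epsilon> + \<epsilon> *\<^sub>R (combination f E (vc \<epsilon>) *v vc \<epsilon>)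
        = lc \<epsilon> *\<^sub>R vc \<epsilon>"
    using branch
    by (auto simp: perturbation_branch_def matrix_vector_mult_add_rdistrib scaleR_matrix_vector_assoc)
  obtain v' where v': "(vc has_vector_derivative v') (at 0)"
    using vc U by (metis at_within_open differentiable_on_def vector_derivative_works)
  have comb: "((\<lambda>\<epsilon>. combination f B (vc \<epsilon>) *v vc \<epsilon>) has_vector_derivative J f B v *v v') (at 0)" for B
  proof -
    have "((\<lambda>\<epsilon>. combination f B (vc \<epsilon>) *v vc \<epsilon>) has_derivative (\<lambda>h. J f B v *v (h *\<^sub>R v'))) (at 0)"
      using v' unfolding has_vector_derivative_def
      by (rule has_derivative_compose) (simp add: at_0 J_has_derivative smooth v)
    then show ?thesis
      by (simp add: has_vector_derivative_def matrix_vector_mult_scaleR)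
  qed
  \<comment> \<open>At 0 the factor eps removes the term with \<open>J f E v\<close>; only
    \<open>E\<close> applied at the unperturbed \<open>v\<close> survives.\<close>
  have "((\<lambda>\<epsilon>. combination f A (vc \<epsilon>) *v vc \<epsilon> + \<epsilon> *\<^sub>R (combination f E (vc \<epsilon>) *v vc \<epsilon>))
      has_vector_derivative J f A v *v v' +
        (0 *\<^sub>R (J f E v *v v') + 1 *\<^sub>R (combination f E (vc 0) *v vc 0))) (at 0)"
    by (intro has_vector_derivative_add has_vector_derivative_scaleR comb DERIV_ident)
  then have 1: "((\<lambda>\<epsilon>. lc \<epsilon> *\<^sub>R vc \<epsilon>) has_vector_derivative
      J f A v *v v' + combination f E v *v v) (at 0)"
    using U eq by (auto simp: at_0 intro: has_vector_derivative_transform_within_open)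
  have 2: "((\<lambda>\<epsilon>. lc \<epsilon> *\<^sub>R vc \<epsilon>) has_vector_derivative lc 0 *\<^sub>R v' + d *\<^sub>R vc 0) (at 0)"
    by (intro has_vector_derivative_scaleR d v')
  have "J f A v *v v' + combination f E v *v v = l *\<^sub>R v' + d *\<^sub>R v"
    using vector_derivative_unique_at[OF 1 2] by (simp add: at_0)
  then have "u \<bullet> (J f A v *v v') + u \<bullet> (combination f E v *v v) = l * (u \<bullet> v') + d * (u \<bullet> v)"
    by (metis inner_add_right inner_scaleR_right)
  moreover have "u \<bullet> (J f A v *v v') = l * (u \<bullet> v')"
    by (simp add: u flip: dot_lmul_matrix)
  ultimately show ?thesis
    by simp
qed

text \<open>This discharges the definite description: a branch exists, and every branch has the same
  derivative because \<open>u \<bullet> v\<close> can be divided out.\<close>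

lemma eigenvalue_deriv_eq:
  fixes f :: "'m::finite \<Rightarrow> real^'n \<Rightarrow> real"
  assumes smooth: "\<And>i. continuously_differentiable_on (- {0}) (f i)"
    and simple: "simple_eigenpair f A l v" and normalized: "(1/2) * (v \<bullet> v) = 1"
    and u: "u v* J f A v = l *\<^sub>R u" "u \<noteq> 0"
  shows "eigenvalue_deriv f A E l v = u \<bullet> (combination f E v *v v) / (u \<bullet> v)"
proof -
  have v: "v \<noteq> 0"
    using normalized by auto
  have "u \<bullet> v \<noteq> 0"
    using left_eigenvector_not_orthogonal[of "J f A v" v l u] simple u
    by (auto simp: simple_eigenpair_def eigenpair_def)
  then have unique: "d = u \<bullet> (combination f E v *v v) / (u \<bullet> v)"
    if "perturbation_branch f A E l v U lc vc" "(lc has_real_derivative d) (at 0)" for U lc vc d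
    using perturbation_branch_deriv[OF smooth v u(1) that] by (simp add: field_simps)
  obtain U lc vc where branch: "perturbation_branch f A E l v U lc vc"
    using perturbation_branch_exists[OF smooth simple normalized] by blast
  then have "lc differentiable (at 0)"
    unfolding perturbation_branch_def by (metis at_within_open differentiable_on_def)
  then obtain d where "(lc has_real_derivative d) (at 0)"
    by (auto simp: real_differentiable_def)
  with branch show ?thesis
    unfolding eigenvalue_deriv_def by (intro the_equality) (use unique in blast)+
qed

subsection \<open>Extremal perturbations\<close>

text \<open>The inner product on the matrix type is thus the Frobenius one, so Cauchy-Schwarz
  applies to matrices directly.\<close>

lemma frobenius_norm_eq_norm: "frobenius_norm = norm"
  by (rule ext) (simp add: frobenius_norm_def norm_vec_def L2_set_def sum_nonneg)

section \<open>Rank-one matrices and bounds for the bilinear form\<close>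

definition outer :: "real^'n \<Rightarrow> real^'n \<Rightarrow> real^'n^'n" where
  "outer x y = (\<chi> i j. x $ i * y $ j)"

lemma outer_mult: "outer x y *v z = (y \<bullet> z) *\<^sub>R x"
  by (simp add: outer_def matrix_vector_mult_def vec_eq_iff inner_vec_def sum_distrib_right
      sum_distrib_left mult_ac)

text \<open>Exhibits the bilinear form as a linear functional of the matrix, represented by a
  rank-one matrix.\<close>

lemma inner_outer: "M \<bullet> outer x y = x \<bullet> (M *v y)"
  by (simp add: outer_def inner_vec_def matrix_vector_mult_def sum_distrib_left mult_ac)

lemma transpose_outer: "transpose (outer x y) = outer y x"
  by (simp add: outer_def transpose_def vec_eq_iff mult.commute)

lemma norm_outer: "norm (outer x y) = norm x * norm y"
proof -
  have "(norm (outer x y))\<^sup>2 = (norm x * norm y)\<^sup>2"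
    by (simp add: power2_norm_eq_inner inner_outer outer_mult power_mult_distrib)
  then show ?thesis
    by (simp add: power2_eq_iff_nonneg)
qed

lemma transpose_scaleR: "transpose (t *\<^sub>R M) = t *\<^sub>R transpose (M :: real^'n^'n)"
  by (simp add: transpose_def vec_eq_iff)

lemma spectral_norm_scaleR: "spectral_norm (t *\<^sub>R M) = \<bar>t\<bar> * spectral_norm M"
  unfolding spectral_norm_def scaleR_matrix_vector_assoc[symmetric]
  by (rule onorm_scaleR) simp

lemma spectral_bound: "\<bar>u \<bullet> (M *v v)\<bar> \<le> norm u * norm v * spectral_norm M"
proof -
  have "norm u * norm (M *v v) \<le> norm u * (spectral_norm M * norm v)"
    unfolding spectral_norm_def by (intro mult_left_mono onorm) simp_all
  then show ?thesis
    using Cauchy_Schwarz_ineq2[of u "M *v v"] by (simp add: mult_ac)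
qed

text \<open>The constant agrees with that of \<open>spectral_bound\<close>, which is why
  \<open>kappa\<close> will be the same for both norms.\<close>

lemma frobenius_bound: "\<bar>u \<bullet> (M *v v)\<bar> \<le> norm u * norm v * frobenius_norm M"
  using Cauchy_Schwarz_ineq2[of M "outer u v"]
  by (simp add: inner_outer norm_outer frobenius_norm_eq_norm mult_ac)

text \<open>The witness is the reflection along \<open>x - y\<close>.\<close>

lemma symmetric_isometry_exchanging:
  fixes x y :: "real^'n"
  assumes "norm x = norm y"
  obtains S where "transpose S = S" "\<And>z. norm (S *v z) = norm z" "S *v y = x"
proof (cases "x = y")
  case True
  show ?thesis
    by (rule that[of "mat 1"]) (simp_all add: True transpose_mat)
next
  case False
  define d where "d = x - y"
  define S where "S = mat 1 - (2 / (d \<bullet> d)) *\<^sub>R outer d d"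
  have d: "d \<bullet> d \<noteq> 0"
    using False by (simp add: d_def)
  have S: "S *v z = z - (2 * (d \<bullet> z) / (d \<bullet> d)) *\<^sub>R d" for z
    by (simp add: S_def matrix_vector_mult_diff_rdistrib outer_mult
        flip: scaleR_matrix_vector_assoc)
  have "transpose S = S"
    by (simp add: S_def transpose_def outer_def mat_def vec_eq_iff mult.commute)
  moreover have "norm (S *v z) = norm z" for z
  proof -
    have "(S *v z) \<bullet> (S *v z) = z \<bullet> z"
      using d by (simp add: S inner_diff_left inner_diff_right inner_commute[of z d] field_simps)
    then show ?thesis
      by (simp add: norm_eq)
  qed
  moreover have "S *v y = x"
  proof -
    \<comment> \<open>Equal norms place \<open>y\<close> so that the reflection adds exactly
      \<open>d\<close> to it.\<close>
    have "x \<bullet> x = y \<bullet> y"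
      using assms by (simp add: norm_eq)
    then have "2 * (d \<bullet> y) = - (d \<bullet> d)"
      by (simp add: d_def inner_diff_left inner_diff_right inner_commute)
    then have "2 * (d \<bullet> y) / (d \<bullet> d) = - 1"
      using d by (simp add: divide_eq_eq)
    then show ?thesis
      unfolding S by (simp add: d_def)
  qed
  ultimately show ?thesis
    by (rule that)
qed

text \<open>Rescaling \<open>u\<close> and \<open>v\<close> to equal norms lets an isometry turn
  \<open>v\<close> into the direction of \<open>u\<close>, giving equality in
  Cauchy-Schwarz.\<close>

lemma spectral_symmetric_maximizer:
  fixes u v :: "real^'n"
  assumes "u \<noteq> 0" "v \<noteq> 0"
  obtains S where "transpose S = S" "spectral_norm S \<le> 1" "u \<bullet> (S *v v) = norm u * norm v"
proof -
  have "norm (norm v *\<^sub>R u) = norm (norm u *\<^sub>R v)"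
    by simp
  then obtain S where S: "transpose S = S" "\<And>z. norm (S *v z) = norm z"
      "S *v (norm u *\<^sub>R v) = norm v *\<^sub>R u"
    by (rule symmetric_isometry_exchanging) blast
  have "spectral_norm S \<le> 1"
    unfolding spectral_norm_def by (rule onorm_bound) (simp_all add: S)
  moreover have "norm u * (u \<bullet> (S *v v)) = norm u * (norm u * norm v)"
    using arg_cong[OF S(3), of "(\<bullet>) u"]
    by (simp add: matrix_vector_mult_scaleR power2_norm_eq_inner[symmetric] power2_eq_square mult_ac)
  then have "u \<bullet> (S *v v) = norm u * norm v"
    using assms(1) by (simp add: mult.commute)
  ultimately show ?thesis
    using S(1) that by blast
qed

lemma frobenius_maximizer:
  fixes u v :: "real^'n"
  assumes "u \<noteq> 0" "v \<noteq> 0"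
  obtains S where "frobenius_norm S \<le> 1" "u \<bullet> (S *v v) = norm u * norm v"
proof
  let ?S = "(1 / (norm u * norm v)) *\<^sub>R outer u v"
  show "frobenius_norm ?S \<le> 1"
    using assms by (simp add: frobenius_norm_eq_norm norm_outer)
  show "u \<bullet> (?S *v v) = norm u * norm v"
    using assms by (simp add: outer_mult power2_norm_eq_inner[symmetric] power2_eq_square
        flip: scaleR_matrix_vector_assoc)
qed

text \<open>On symmetric matrices \<open>u \<bullet> (M *v v)\<close> is the Frobenius inner product with the symmetric part
  of \<open>outer u v\<close>, whose norm is \<open>\<beta> * norm u * norm v\<close>.\<close>

lemma inner_symmetric_outer:
  assumes "transpose M = M"
  shows "M \<bullet> ((1/2) *\<^sub>R (outer u v + outer v u)) = u \<bullet> (M *v v)"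
proof -
  have "v \<bullet> (M *v u) = u \<bullet> (M *v v)"
    by (metis assms dot_lmul_matrix inner_commute transpose_matrix_vector)
  then show ?thesis
    by (simp add: inner_add_right inner_outer)
qed

lemma norm_symmetric_outer:
  fixes u v :: "real^'n"
  assumes "u \<noteq> 0" "v \<noteq> 0"
  shows "norm ((1/2) *\<^sub>R (outer u v + outer v u)) =
    sqrt ((1 + ((u \<bullet> v) / (norm u * norm v))\<^sup>2) / 2) * (norm u * norm v)"
proof -
  define Z where "Z = (1/2) *\<^sub>R (outer u v + outer v u)"
  have "transpose Z = Z"
    by (simp add: Z_def outer_def transpose_def vec_eq_iff mult.commute)
  \<comment> \<open>As \<open>Z\<close> is itself symmetric, its squared norm is the bilinear form
    evaluated at \<open>Z\<close>.\<close>
  then have "(norm Z)\<^sup>2 = u \<bullet> (Z *v v)"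
    by (metis Z_def inner_symmetric_outer power2_norm_eq_inner)
  also have "Z *v v = (1/2) *\<^sub>R ((v \<bullet> v) *\<^sub>R u + (u \<bullet> v) *\<^sub>R v)"
    by (simp add: Z_def matrix_vector_mult_add_rdistrib outer_mult
        flip: scaleR_matrix_vector_assoc)
  also have "u \<bullet> \<dots> = ((norm u * norm v)\<^sup>2 + (u \<bullet> v)\<^sup>2) / 2"
    by (simp add: inner_add_right power2_norm_eq_inner power_mult_distrib power2_eq_square[of "u \<bullet> v"])
  also have "\<dots> = (1 + ((u \<bullet> v) / (norm u * norm v))\<^sup>2) / 2 * (norm u * norm v)\<^sup>2"
    using assms by (simp add: field_simps)
  finally have "norm Z = sqrt ((1 + ((u \<bullet> v) / (norm u * norm v))\<^sup>2) / 2 * (norm u * norm v)\<^sup>2)"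
    by (metis norm_ge_zero real_sqrt_unique)
  then show ?thesis
    unfolding real_sqrt_mult[of _ "(norm u * norm v)\<^sup>2"] by (simp add: Z_def)
qed

lemma frobenius_symmetric_bound:
  assumes "transpose M = M"
  shows "\<bar>u \<bullet> (M *v v)\<bar> \<le> norm ((1/2) *\<^sub>R (outer u v + outer v u)) * frobenius_norm M"
  using Cauchy_Schwarz_ineq2[of M "(1/2) *\<^sub>R (outer u v + outer v u)"]
  unfolding inner_symmetric_outer[OF assms] frobenius_norm_eq_norm by (simp add: mult.commute)

lemma frobenius_symmetric_maximizer:
  fixes u v :: "real^'n"
  obtains S where "transpose S = S" "frobenius_norm S \<le> 1"
    "u \<bullet> (S *v v) = norm ((1/2) *\<^sub>R (outer u v + outer v u))"
proof -
  define Z where "Z = (1/2) *\<^sub>R (outer u v + outer v u)"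
  have Z: "transpose Z = Z"
    by (simp add: Z_def outer_def transpose_def vec_eq_iff mult.commute)
  \<comment> \<open>If \<open>Z = 0\<close>, division by zero gives the zero matrix, for which the
    claims still hold.\<close>
  let ?S = "(1 / norm Z) *\<^sub>R Z"
  have S: "transpose ?S = ?S"
    by (simp add: transpose_scaleR Z)
  moreover have "frobenius_norm ?S \<le> 1"
    by (simp add: frobenius_norm_eq_norm)
  moreover have "u \<bullet> (?S *v v) = norm Z"
    unfolding inner_symmetric_outer[OF S, symmetric] Z_def[symmetric]
    by (simp add: power2_norm_eq_inner[symmetric] power2_eq_square)
  ultimately show ?thesis
    using that by (simp add: Z_def)
qed

text \<open>A common template: \<open>P\<close> is the structural constraint, \<open>c\<close> the
  best constant for the bilinear form under it, and \<open>S\<close> a matrix attaining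
  \<open>c\<close>. The triangle inequality gives the upper bound, and multiples of \<open>S\<close>
  attain it.\<close>

lemma SUP_linear_functional:
  fixes f :: "'m::finite \<Rightarrow> real^'n \<Rightarrow> real" and N :: "real^'n^'n \<Rightarrow> real"
    and D :: "('m \<Rightarrow> real^'n^'n) \<Rightarrow> real"
  assumes w: "\<And>i. w i \<ge> 0"
    and D: "\<And>E. D E = u \<bullet> (combination f E v *v v) / r"
    and bound: "\<And>M. P M \<Longrightarrow> \<bar>u \<bullet> (M *v v)\<bar> \<le> c * N M" and c: "c \<ge> 0"
    and S: "u \<bullet> (S *v v) = c" "N S \<le> 1" "\<And>t. P (t *\<^sub>R S)"
    and N: "\<And>t. N (t *\<^sub>R S) = \<bar>t\<bar> * N S"
  shows "(SUP E\<in>{E. \<forall>i. N (E i) \<le> w i \<and> P (E i)}. ereal (\<bar>D E\<bar> / \<bar>l\<bar>)) =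
    ereal (c * ((\<Sum>i\<in>UNIV. \<bar>f i v\<bar> * w i) / (\<bar>r\<bar> * \<bar>l\<bar>)))"
proof (rule SUP_eqI)
  have expand: "u \<bullet> (combination f E v *v v) = (\<Sum>i\<in>UNIV. f i v * (u \<bullet> (E i *v v)))" for E
    unfolding combination_def inner_outer[symmetric] by (simp add: inner_sum_left)
  show "ereal (\<bar>D E\<bar> / \<bar>l\<bar>) \<le> ereal (c * ((\<Sum>i\<in>UNIV. \<bar>f i v\<bar> * w i) / (\<bar>r\<bar> * \<bar>l\<bar>)))"
    if E: "E \<in> {E. \<forall>i. N (E i) \<le> w i \<and> P (E i)}" for E
  proof -
    have "\<bar>u \<bullet> (combination f E v *v v)\<bar> \<le> (\<Sum>i\<in>UNIV. \<bar>f i v * (u \<bullet> (E i *v v))\<bar>)"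
      unfolding expand by (rule sum_abs)
    also have "\<dots> \<le> (\<Sum>i\<in>UNIV. \<bar>f i v\<bar> * (c * w i))"
      unfolding abs_mult
    proof (intro sum_mono mult_left_mono)
      fix i
      have "\<bar>u \<bullet> (E i *v v)\<bar> \<le> c * N (E i)"
        using E by (intro bound) simp
      also have "\<dots> \<le> c * w i"
        using E c by (intro mult_left_mono) simp_all
      finally show "\<bar>u \<bullet> (E i *v v)\<bar> \<le> c * w i" .
    qed simp
    also have "\<dots> = c * (\<Sum>i\<in>UNIV. \<bar>f i v\<bar> * w i)"
      by (simp add: sum_distrib_left mult_ac)
    finally have "\<bar>u \<bullet> (combination f E v *v v)\<bar> / (\<bar>r\<bar> * \<bar>l\<bar>) \<le>
        c * (\<Sum>i\<in>UNIV. \<bar>f i v\<bar> * w i) / (\<bar>r\<bar> * \<bar>l\<bar>)"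
      by (rule divide_right_mono) simp
    then show ?thesis
      by (simp add: D abs_divide)
  qed
  \<comment> \<open>One maximizer serves every index; the signs make all contributions add up
    without cancellation.\<close>
  define E where "E i = (sgn (f i v) * w i) *\<^sub>R S" for i
  have "N (E i) \<le> w i" for i
  proof -
    have "N (E i) = \<bar>sgn (f i v) * w i\<bar> * N S"
      by (simp add: E_def N)
    also have "\<dots> \<le> \<bar>sgn (f i v) * w i\<bar> * 1"
      using S(2) by (intro mult_left_mono) simp_all
    also have "\<dots> \<le> w i"
      using w[of i] by (simp add: abs_mult sgn_if)
    finally show ?thesis .
  qed
  then have mem: "E \<in> {E. \<forall>i. N (E i) \<le> w i \<and> P (E i)}"
    by (simp add: E_def S(3))
  have "u \<bullet> (combination f E v *v v) = (\<Sum>i\<in>UNIV. c * (\<bar>f i v\<bar> * w i))"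
    unfolding expand E_def
    by (intro sum.cong refl)
      (simp add: S(1) abs_sgn mult_ac flip: scaleR_matrix_vector_assoc)
  then have "u \<bullet> (combination f E v *v v) = c * (\<Sum>i\<in>UNIV. \<bar>f i v\<bar> * w i)"
    by (simp add: sum_distrib_left)
  then have "\<bar>D E\<bar> / \<bar>l\<bar> = c * ((\<Sum>i\<in>UNIV. \<bar>f i v\<bar> * w i) / (\<bar>r\<bar> * \<bar>l\<bar>))"
    using c w by (simp add: D abs_divide abs_mult sum_nonneg)
  then show "ereal (c * ((\<Sum>i\<in>UNIV. \<bar>f i v\<bar> * w i) / (\<bar>r\<bar> * \<bar>l\<bar>))) \<le> y"
    if "\<And>E. E \<in> {E. \<forall>i. N (E i) \<le> w i \<and> P (E i)} \<Longrightarrow> ereal (\<bar>D E\<bar> / \<bar>l\<bar>) \<le> y" for y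
    using that[OF mem] by simp
qed

theorem theorem3p4:
  fixes f :: "'m::finite \<Rightarrow> real^'n \<Rightarrow> real"
    and A :: "'m \<Rightarrow> real^'n^'n"
    and w :: "'m \<Rightarrow> real"
    and l \<theta> \<beta> :: real
    and u v :: "real^'n"
    and N :: "real^'n^'n \<Rightarrow> real"
  assumes sym: "\<And>i. transpose (A i) = A i"
    and scaling: "\<And>i. scaling_invariant (f i)"
    and smooth: "\<And>i. continuously_differentiable_on (- {0}) (f i)"
    and simple: "simple_eigenpair f A l v"
    and l_nz: "l \<noteq> 0"
    and normalized: "(1/2) * (v \<bullet> v) = 1"
    and u_nz: "u \<noteq> 0"
    and left_eigenvector: "u v* J f A v = l *\<^sub>R u"
    and theta: "\<theta> = arccos ((u \<bullet> v) / (norm u * norm v))"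
    and beta: "\<beta> = sqrt ((1 + (cos \<theta>)\<^sup>2) / 2)"
    and weights: "\<And>i. w i \<ge> 0"
    and N: "N = spectral_norm \<or> N = frobenius_norm"
  shows "kappa_sym spectral_norm f A w l v = kappa N f A w l v \<and>
         kappa_sym frobenius_norm f A w l v = ereal \<beta> * kappa N f A w l v"
proof -
  let ?D = "\<lambda>E. eigenvalue_deriv f A E l v"
  let ?n = "norm u * norm v"
  let ?z = "norm ((1/2) *\<^sub>R (outer u v + outer v u))"
  \<comment> \<open>The factor shared by all condition numbers; they differ only in the constant
    \<open>?n\<close> or \<open>?z\<close>.\<close>
  define K where "K = (\<Sum>i\<in>UNIV. \<bar>f i v\<bar> * w i) / (\<bar>u \<bullet> v\<bar> * \<bar>l\<bar>)"
  have D: "?D E = u \<bullet> (combination f E v *v v) / (u \<bullet> v)" for E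
    by (rule eigenvalue_deriv_eq[OF smooth simple normalized left_eigenvector u_nz])
  have v_nz: "v \<noteq> 0"
    using normalized by auto
  obtain S where S: "transpose S = S" "spectral_norm S \<le> 1" "u \<bullet> (S *v v) = ?n"
    using spectral_symmetric_maximizer[OF u_nz v_nz] by blast
  obtain R where R: "frobenius_norm R \<le> 1" "u \<bullet> (R *v v) = ?n"
    using frobenius_maximizer[OF u_nz v_nz] by blast
  obtain T where T: "transpose T = T" "frobenius_norm T \<le> 1" "u \<bullet> (T *v v) = ?z"
    using frobenius_symmetric_maximizer[of u v] by blast
  note sup = SUP_linear_functional[where D = ?D, OF weights D]
  have frobenius_scaleR: "frobenius_norm (t *\<^sub>R M) = \<bar>t\<bar> * frobenius_norm M" for t and M :: "real^'n^'n"
    by (simp add: frobenius_norm_eq_norm)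
  have sym_spectral: "kappa_sym spectral_norm f A w l v = ereal (?n * K)"
    unfolding kappa_sym_def K_def
    by (rule sup[where P = "\<lambda>M. transpose M = M" and S = S])
      (simp_all add: S spectral_bound spectral_norm_scaleR transpose_scaleR)
  have spectral: "kappa spectral_norm f A w l v = ereal (?n * K)"
    unfolding kappa_def K_def
    \<comment> \<open>The trivial constraint must be simplified away before the index set matches
      that of \<open>kappa\<close>.\<close>
    using sup[where P = "\<lambda>_. True" and S = S and N = spectral_norm and c = ?n]
    by (simp add: S spectral_bound spectral_norm_scaleR)
  have frobenius: "kappa frobenius_norm f A w l v = ereal (?n * K)"
    unfolding kappa_def K_def
    using sup[where P = "\<lambda>_. True" and S = R and N = frobenius_norm and c = ?n]
    by (simp add: R frobenius_bound frobenius_scaleR)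
  have sym_frobenius: "kappa_sym frobenius_norm f A w l v = ereal (?z * K)"
    unfolding kappa_sym_def K_def
    by (rule sup[where P = "\<lambda>M. transpose M = M" and S = T])
      (simp_all only: T frobenius_symmetric_bound frobenius_scaleR transpose_scaleR norm_ge_zero)
  \<comment> \<open>Cauchy-Schwarz puts the quotient in the range where \<open>cos\<close> undoes
    \<open>arccos\<close>.\<close>
  have "\<bar>(u \<bullet> v) / ?n\<bar> \<le> 1"
    using Cauchy_Schwarz_ineq2[of u v] u_nz v_nz by (simp add: abs_divide divide_le_eq)
  then have "cos \<theta> = (u \<bullet> v) / ?n"
    unfolding theta by (intro cos_arccos) linarith+
  then have "?z = \<beta> * ?n"
    unfolding beta using norm_symmetric_outer[OF u_nz v_nz] by simp
  with N show ?thesis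
    unfolding sym_frobenius by (auto simp: sym_spectral spectral frobenius mult.assoc)
qed

end
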